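(* Let $G$ be a finite double-magical graph. If $\omega(G)=k$, then $\chi(G)\leq\frac{k+1}{2}\binom{k+2}{3}$.
   Context: A double-ordered graph $H_{<,<'}$ (graph with two total orders on its vertex set) is magical if for any three distinct vertices $a< b< c$ with $ab,bc\in E(H)$ and $ac\notin E(H)$ we have $b<' a$ and $b<' c$. A triple-ordered graph $G_{<_1,<_2,<_3}$ (graph with three total orders on its vertex set) is double-magical if there exist graphs $G^1,G^2$ on $V(G)$ such that $G^1_{<_1,<_2}$ and $G^2_{<_1,<_3}$ are magical and $E(G)=E(G^1)\cap E(G^2)$. A graph $G$ is double-magical if there exist total orders $<_1,<_2,<_3$ on $V(G)$ such that $G_{<_1,<_2,<_3}$ is double-magical. $\omega$ and $\chi$ denote clique number and chromatic number. *)

theory Defs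
  imports Complex_Main "Graph_Theory.Pair_Digraph"
begin

text \<open>
  Simple graphs are modelled as symmetric loop-free digraphs: an edge \<open>uv\<close> corresponds to the two
  arcs \<open>(u, v)\<close> and \<open>(v, u)\<close>. The locale \<open>pair_bidirected_digraph\<close> describes arbitrary simple
  graphs, and \<open>pair_graph\<close> describes the finite ones. Total orders are given by their strict
  relations, \<open>(a, b) \<in> L\<close> meaning \<open>a < b\<close>; pairs outside the vertex set play no role.
\<close>

definition magical :: "'a pair_pre_digraph \<Rightarrow> 'a rel \<Rightarrow> 'a rel \<Rightarrow> bool" where
  "magical H L L' \<longleftrightarrow>
     pair_bidirected_digraph H \<and>
     strict_linear_order_on (pverts H) L \<and> strict_linear_order_on (pverts H) L' \<and>
     (\<forall>a\<in>pverts H. \<forall>b\<in>pverts H. \<forall>c\<in>pverts H.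
        (a, b) \<in> L \<and> (b, c) \<in> L \<and>
        (a, b) \<in> parcs H \<and> (b, c) \<in> parcs H \<and> (a, c) \<notin> parcs H \<longrightarrow>
        (b, a) \<in> L' \<and> (b, c) \<in> L')"

definition double_magical_ordered ::
    "'a pair_pre_digraph \<Rightarrow> 'a rel \<Rightarrow> 'a rel \<Rightarrow> 'a rel \<Rightarrow> bool" where
  "double_magical_ordered G L1 L2 L3 \<longleftrightarrow>
     pair_bidirected_digraph G \<and>
     strict_linear_order_on (pverts G) L1 \<and>
     strict_linear_order_on (pverts G) L2 \<and>
     strict_linear_order_on (pverts G) L3 \<and>
     (\<exists>G1 G2. pverts G1 = pverts G \<and> pverts G2 = pverts G \<and>
        magical G1 L1 L2 \<and> magical G2 L1 L3 \<and>
        parcs G = parcs G1 \<inter> parcs G2)"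

definition double_magical :: "'a pair_pre_digraph \<Rightarrow> bool" where
  "double_magical G \<longleftrightarrow> (\<exists>L1 L2 L3. double_magical_ordered G L1 L2 L3)"

definition clique :: "'a pair_pre_digraph \<Rightarrow> 'a set \<Rightarrow> bool" where
  "clique G K \<longleftrightarrow> K \<subseteq> pverts G \<and> (\<forall>u\<in>K. \<forall>v\<in>K. u \<noteq> v \<longrightarrow> (u, v) \<in> parcs G)"

definition proper_colouring :: "'a pair_pre_digraph \<Rightarrow> nat \<Rightarrow> ('a \<Rightarrow> nat) \<Rightarrow> bool" where
  "proper_colouring G n f \<longleftrightarrow>
     f ` pverts G \<subseteq> {..<n} \<and> (\<forall>(u, v)\<in>parcs G. f u \<noteq> f v)"

text \<open>The following two numbers are only meaningful for finite graphs.\<close>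

definition clique_number :: "'a pair_pre_digraph \<Rightarrow> nat" where
  "clique_number G = Max {card K | K. clique G K}"

definition chromatic_number :: "'a pair_pre_digraph \<Rightarrow> nat" where
  "chromatic_number G = (LEAST n. \<exists>f. proper_colouring G n f)"

end

theory Submission
  imports Defs
begin

text \<open>
  Write an edge \<open>ab\<close> of \<open>G\<close> with \<open>a <\<^sub>1 b\<close> as an arc \<open>a \<rightarrow> b\<close>, and say that it goes up or down in
  \<open><\<^sub>2\<close> and in \<open><\<^sub>3\<close>. Arcs \<open>a \<rightarrow> b \<rightarrow> c\<close> compose to an edge unless, in one of the two orders, the first
  goes down and the second goes up. Colour \<open>v\<close> by four numbers: the size \<open>a\<close> of a largest chain of
  up-up arcs ending at \<open>v\<close>, and the sizes \<open>b\<close>, \<open>c\<close>, \<open>d\<close> of largest chains starting at \<open>v\<close> whose arcs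
  go down in \<open><\<^sub>3\<close>, in \<open><\<^sub>2\<close>, and in both (not counting \<open>v\<close>). Each arc changes the number that
  belongs to its type. A chain counted by \<open>a\<close> extends one counted by \<open>b\<close> or \<open>c\<close> to a clique, so
  \<open>a + b < k\<close> and \<open>a + c < k\<close>, while \<open>d \<le> b\<close> and \<open>d \<le> c\<close>; the bound is the number of quadruples
  satisfying these inequalities.
\<close>

section \<open>Heights of vertices in a relation\<close>

definition chain_in :: "'a rel \<Rightarrow> 'a set \<Rightarrow> bool" where
  "chain_in R S \<longleftrightarrow> (\<forall>x\<in>S. \<forall>y\<in>S. x \<noteq> y \<longrightarrow> (x, y) \<in> R \<or> (y, x) \<in> R)"

text \<open>Chains are compared pairwise because \<open>B\<close> and \<open>C\<close> below need
  not be transitive; this makes every chain of arcs a clique. For irreflexive \<open>R\<close>,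
  \<open>v\<close> itself is not counted.\<close>

definition chain_height :: "'a rel \<Rightarrow> 'a \<Rightarrow> nat" where
  "chain_height R v = Max (card ` {S. S \<subseteq> R `` {v} \<and> chain_in R S})"

lemma finite_chains: "finite R \<Longrightarrow> finite {S. S \<subseteq> R `` {v} \<and> chain_in R S}"
  by (rule finite_subset[of _ "Pow (R `` {v})"]) auto

lemma chain_height_ge:
  assumes "finite R" "S \<subseteq> R `` {v}" "chain_in R S"
  shows "card S \<le> chain_height R v"
  unfolding chain_height_def using assms finite_chains by (intro Max_ge) auto

lemma chain_height_witness:
  assumes "finite R"
  obtains S where "S \<subseteq> R `` {v}" "chain_in R S" "card S = chain_height R v"
proof -
  have "{} \<in> {S. S \<subseteq> R `` {v} \<and> chain_in R S}"
    by (simp add: chain_in_def)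
  then have "chain_height R v \<in> card ` {S. S \<subseteq> R `` {v} \<and> chain_in R S}"
    unfolding chain_height_def using finite_chains[OF assms] by (intro Max_in) auto
  then show ?thesis
    using that by auto
qed

text \<open>A largest chain counted at \<open>v\<close> together with \<open>v\<close> is a chain
  counted at \<open>u\<close>, and \<open>v\<close> is new because \<open>R\<close> is
  irreflexive.\<close>

lemma chain_height_less:
  assumes "finite R" "irrefl R" "(u, v) \<in> R" "R `` {v} \<subseteq> R `` {u}"
  shows "chain_height R v < chain_height R u"
proof -
  obtain S where S: "S \<subseteq> R `` {v}" "chain_in R S" "card S = chain_height R v"
    using chain_height_witness[OF assms(1)] .
  have "finite S"
    using S(1) assms(1) by (meson finite_Image finite_subset)
  moreover have "v \<notin> S"
    using S(1) assms(2) by (auto simp: irrefl_def)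
  moreover have "card (insert v S) \<le> chain_height R u"
    using S assms by (intro chain_height_ge) (auto simp: chain_in_def)
  ultimately show ?thesis
    using S(3) by simp
qed

lemma chain_height_mono:
  assumes "finite R'" "R \<subseteq> R'"
  shows "chain_height R v \<le> chain_height R' v"
proof -
  obtain S where S: "S \<subseteq> R `` {v}" "chain_in R S" "card S = chain_height R v"
    using chain_height_witness[OF finite_subset[OF assms(2,1)]] .
  have "card S \<le> chain_height R' v"
    using S assms by (intro chain_height_ge) (auto simp: chain_in_def)
  then show ?thesis
    using S(3) by simp
qed

section \<open>Cliques built from chains\<close>

lemma clique_card_le:
  assumes "finite (pverts G)" "clique G K"
  shows "card K \<le> clique_number G"
proof -
  have "{card K |K. clique G K} \<subseteq> card ` Pow (pverts G)"
    by (auto simp: clique_def)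
  then have "finite {card K |K. clique G K}"
    using assms(1) by (meson finite_Pow_iff finite_imageI finite_subset)
  then show ?thesis
    unfolding clique_number_def using assms(2) by (intro Max_ge) auto
qed

text \<open>\<open>R\<close>-chains lie below \<open>v\<close> in \<open>L\<close> and
  \<open>Q\<close>-chains above it, so they are disjoint and miss \<open>v\<close>, and
  \<open>comp\<close> joins them. Counting \<open>v\<close> as well makes the inequality
  strict.\<close>

lemma chain_heights_clique:
  assumes "finite (pverts G)" "sym (parcs G)" "parcs G \<subseteq> pverts G \<times> pverts G"
    and "v \<in> pverts G" "irrefl L" "trans L"
    and R: "R \<subseteq> parcs G \<inter> L\<inverse>" and Q: "Q \<subseteq> parcs G \<inter> L"
    and comp: "\<And>x y. (v, x) \<in> R \<Longrightarrow> (v, y) \<in> Q \<Longrightarrow> (x, y) \<in> parcs G"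
  shows "chain_height R v + chain_height Q v < clique_number G"
proof -
  have fin: "finite (parcs G)"
    using assms(1,3) by (meson finite_SigmaI finite_subset)
  then have finR: "finite R" and finQ: "finite Q"
    using R Q finite_subset by blast+
  obtain S where S: "S \<subseteq> R `` {v}" "chain_in R S" "card S = chain_height R v"
    using chain_height_witness[OF finR] .
  obtain T where T: "T \<subseteq> Q `` {v}" "chain_in Q T" "card T = chain_height Q v"
    using chain_height_witness[OF finQ] .
  have finS: "finite S" and finT: "finite T"
    using S(1) T(1) finR finQ by (meson finite_Image finite_subset)+
  have below: "(x, v) \<in> L" "(v, x) \<in> parcs G" "(x, v) \<in> parcs G" if "x \<in> S" for x
    using that S(1) R assms(2) by (auto dest: symD)
  have above: "(v, x) \<in> L" "(v, x) \<in> parcs G" "(x, v) \<in> parcs G" if "x \<in> T" for x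
    using that T(1) Q assms(2) by (auto dest: symD)
  have "v \<notin> S \<union> T"
    using below(1) above(1) \<open>irrefl L\<close> by (auto simp: irrefl_def)
  moreover have "S \<inter> T = {}"
    using below(1) above(1) \<open>irrefl L\<close> \<open>trans L\<close> by (auto simp: irrefl_def dest: transD)
  ultimately have "card (insert v (S \<union> T)) = Suc (card S + card T)"
    using finS finT by (simp add: card_Un_disjoint)
  moreover have "clique G (insert v (S \<union> T))"
  proof -
    have ST: "(x, y) \<in> parcs G \<and> (y, x) \<in> parcs G" if "x \<in> S" "y \<in> T" for x y
      using that S(1) T(1) comp assms(2) by (blast dest: symD)
    have SS: "(x, y) \<in> parcs G" if "x \<in> S" "y \<in> S" "x \<noteq> y" for x y
      using that S(2) R assms(2) unfolding chain_in_def by (blast dest: symD)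
    have TT: "(x, y) \<in> parcs G" if "x \<in> T" "y \<in> T" "x \<noteq> y" for x y
      using that T(2) Q assms(2) unfolding chain_in_def by (blast dest: symD)
    have "insert v (S \<union> T) \<subseteq> pverts G"
      using below(2) above(2) assms(3,4) by blast
    then show ?thesis
      unfolding clique_def using ST SS TT below(2,3) above(2,3)
      by (intro conjI ballI impI) (auto elim!: insertE UnE)
  qed
  ultimately show ?thesis
    using clique_card_le[OF assms(1), of "insert v (S \<union> T)"] S(3) T(3) by simp
qed

section \<open>Composition of arcs in magical graphs\<close>

lemma bidirected_arcs_subset:
  assumes "pair_bidirected_digraph G"
  shows "parcs G \<subseteq> pverts G \<times> pverts G"
proof -
  interpret pair_bidirected_digraph G
    by fact
  show ?thesis
    using arc_fst_in_verts arc_snd_in_verts by fastforce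
qed

text \<open>Were \<open>ac\<close> missing, \<open>b\<close> would lie below both \<open>a\<close>
  and \<open>c\<close> in \<open>L'\<close>; each disjunct of the last hypothesis rules out one of
  these.\<close>

lemma magical_compose:
  assumes "magical H L L'" "(a, b) \<in> parcs H" "(b, c) \<in> parcs H" "(a, b) \<in> L" "(b, c) \<in> L"
    and "(a, b) \<in> L' \<or> (c, b) \<in> L'"
  shows "(a, c) \<in> parcs H"
proof -
  have H: "pair_bidirected_digraph H" and "strict_linear_order_on (pverts H) L'"
    using assms(1) by (auto simp: magical_def)
  then have "irrefl L'" "trans L'"
    by (auto simp: strict_linear_order_on_def)
  then have "\<not> ((b, a) \<in> L' \<and> (b, c) \<in> L')"
    using assms(6) by (auto simp: irrefl_def dest: transD)
  moreover have "a \<in> pverts H" "b \<in> pverts H" "c \<in> pverts H"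
    using assms(2,3) bidirected_arcs_subset[OF H] by auto
  ultimately show ?thesis
    using assms(1-5) unfolding magical_def by blast
qed

section \<open>Colours from a finite set, and the number of height vectors\<close>

lemma chromatic_number_le_card:
  assumes "finite T" "g ` pverts G \<subseteq> T" "parcs G \<subseteq> pverts G \<times> pverts G"
    and "\<And>u v. (u, v) \<in> parcs G \<Longrightarrow> g u \<noteq> g v"
  shows "chromatic_number G \<le> card T"
proof -
  obtain h where h: "bij_betw h T {..<card T}"
    using ex_bij_betw_finite_nat[OF assms(1)] by (auto simp: atLeast0LessThan)
  have "proper_colouring G (card T) (h \<circ> g)"
    unfolding proper_colouring_def
  proof (intro conjI ballI)
    show "(h \<circ> g) ` pverts G \<subseteq> {..<card T}"
      using h assms(2) unfolding bij_betw_def by auto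
    fix e assume e: "e \<in> parcs G"
    obtain u v where uv: "e = (u, v)"
      by (cases e)
    have "g u \<in> T" "g v \<in> T" "g u \<noteq> g v"
      using e uv assms(2-4) by auto
    then show "case e of (u, v) \<Rightarrow> (h \<circ> g) u \<noteq> (h \<circ> g) v"
      using h uv by (auto simp: bij_betw_def dest: inj_onD)
  qed
  then show ?thesis
    unfolding chromatic_number_def by (intro Least_le) blast
qed

text \<open>The entries are \<open>a\<close>, \<open>d\<close>, \<open>b\<close>, \<open>c\<close>
  in this order: once \<open>a\<close> and \<open>d\<close> are fixed, \<open>b\<close> and
  \<open>c\<close> range independently over the same interval.\<close>

definition height_vectors :: "nat \<Rightarrow> (nat \<times> nat \<times> nat \<times> nat) set" where
  "height_vectors k = (SIGMA a:{..<k}. SIGMA d:{..<k - a}. {d..<k - a} \<times> {d..<k - a})"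

text \<open>There are \<open>(k - a - d)^2\<close> vectors for given \<open>a\<close> and
  \<open>d\<close>. Summing over \<open>d\<close> gives a sum of consecutive squares, and summing
  those over \<open>a\<close> gives \<open>k (k + 1)^2 (k + 2) / 12\<close>. The factors 6 and 12
  keep the inductions within the naturals.\<close>

lemma card_height_vectors:
  "real (card (height_vectors k)) = (real k + 1) / 2 * real ((k + 2) choose 3)"
proof -
  have squares: "6 * (\<Sum>d<m. (m - d) * (m - d)) = m * (m + 1) * (2 * m + 1)" for m :: nat
  proof (induction m)
    case (Suc m)
    \<comment> \<open>Splitting off \<open>d = 0\<close> and shifting the index leaves the sum for
      \<open>m\<close>.\<close>
    have "(\<Sum>d<Suc m. (Suc m - d) * (Suc m - d)) =
        Suc m * Suc m + (\<Sum>d<m. (m - d) * (m - d))"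
      by (simp add: sum.lessThan_Suc_shift del: sum.lessThan_Suc)
    then show ?case
      by (simp only: add_mult_distrib2 Suc.IH) (simp add: algebra_simps)
  qed simp
  have "12 * (\<Sum>a<k. \<Sum>d<k - a. (k - a - d) * (k - a - d)) = k * (k + 1) * (k + 1) * (k + 2)"
  proof (induction k)
    case (Suc k)
    let ?s = "\<Sum>d<Suc k. (Suc k - d) * (Suc k - d)"
    have "(\<Sum>a<Suc k. \<Sum>d<Suc k - a. (Suc k - a - d) * (Suc k - a - d)) =
        ?s + (\<Sum>a<k. \<Sum>d<k - a. (k - a - d) * (k - a - d))"
      by (simp add: sum.lessThan_Suc_shift del: sum.lessThan_Suc)
    moreover have "12 * ?s = 2 * (Suc k * (Suc k + 1) * (2 * Suc k + 1))"
      using squares[of "Suc k"] by linarith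
    ultimately show ?case
      by (simp only: add_mult_distrib2 Suc.IH) (simp add: algebra_simps)
  qed simp
  moreover have "card (height_vectors k) = (\<Sum>a<k. \<Sum>d<k - a. (k - a - d) * (k - a - d))"
    by (simp add: height_vectors_def)
  ultimately have "12 * card (height_vectors k) = k * (k + 1) * (k + 1) * (k + 2)"
    by simp
  moreover have "6 * ((k + 2) choose 3) = k * (k + 1) * (k + 2)"
  proof -
    have two: "2 * (Suc n choose 2) = n * (n + 1)" for n
      by (induction n) (simp_all add: numeral_2_eq_2)
    show ?thesis
    proof (induction k)
      case (Suc k)
      have "Suc k + 2 choose 3 = (Suc (k + 1) choose 2) + (k + 2 choose 3)"
        by (simp add: numeral_3_eq_3 numeral_2_eq_2)
      moreover have "6 * (Suc (k + 1) choose 2) = 3 * ((k + 1) * (k + 1 + 1))"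
        using two[of "k + 1"] by linarith
      ultimately show ?case
        by (simp only: add_mult_distrib2 Suc.IH) (simp add: algebra_simps)
    qed simp
  qed
  ultimately have "12 * card (height_vectors k) = (k + 1) * (6 * ((k + 2) choose 3))"
    by (simp only: ac_simps)
  then have "2 * card (height_vectors k) = (k + 1) * ((k + 2) choose 3)"
    by simp
  then have "2 * real (card (height_vectors k)) = (real k + 1) * real ((k + 2) choose 3)"
    by (metis (mono_tags, lifting) of_nat_1 of_nat_add of_nat_mult of_nat_numeral)
  then show ?thesis
    by simp
qed

section \<open>The colouring by heights\<close>

theorem theorem8:
  fixes G :: "'a pair_pre_digraph" and k :: nat
  assumes "pair_graph G"
    and "double_magical G"
    and "clique_number G = k"
  shows "real (chromatic_number G) \<le> (real k + 1) / 2 * real ((k + 2) choose 3)"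
proof -
  obtain L1 L2 L3 where ord: "double_magical_ordered G L1 L2 L3"
    using assms(2) unfolding double_magical_def by blast
  then obtain G1 G2 where m1: "magical G1 L1 L2" and m2: "magical G2 L1 L3"
    and E: "parcs G = parcs G1 \<inter> parcs G2"
    unfolding double_magical_ordered_def by blast
  have orders: "trans L1" "irrefl L1" "total_on (pverts G) L1" "trans L2" "irrefl L2"
    "total_on (pverts G) L2" "trans L3" "irrefl L3" "total_on (pverts G) L3"
    using ord by (auto simp: double_magical_ordered_def strict_linear_order_on_def)
  interpret pair_graph G
    by fact
  have arcs: "parcs G \<subseteq> pverts G \<times> pverts G"
    by (rule bidirected_arcs_subset) unfold_locales
  have sym: "sym (parcs G)"
    using pair_sym_arcs by (simp add: symmetric_def)
  have loopless: "u \<noteq> v" if "(u, v) \<in> parcs G" for u v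
    using no_loops'[OF that] .
  \<comment> \<open>\<open>A\<close> is reversed, since its height counts chains ending at the
    vertex. \<open>B\<close> and \<open>C\<close> leave the other order free, so that
    \<open>D\<close> is contained in both.\<close>
  define A where "A = parcs G \<inter> L1\<inverse> \<inter> L2\<inverse> \<inter> L3\<inverse>"
  define B where "B = parcs G \<inter> L1 \<inter> L3\<inverse>"
  define C where "C = parcs G \<inter> L1 \<inter> L2\<inverse>"
  define D where "D = B \<inter> C"
  define g where "g v = (chain_height A v, chain_height D v, chain_height B v, chain_height C v)"
    for v
  have fin: "finite A" "finite B" "finite C" "finite D"
    unfolding A_def B_def C_def D_def by auto
  have irr: "irrefl A" "irrefl B" "irrefl C" "irrefl D"
    using orders(2) by (auto simp: A_def B_def C_def D_def irrefl_def)
  have compose: "(x, z) \<in> parcs G \<inter> L1"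
    if "(x, y) \<in> parcs G" "(y, z) \<in> parcs G" "(x, y) \<in> L1" "(y, z) \<in> L1"
      "(x, y) \<in> L2 \<or> (z, y) \<in> L2" "(x, y) \<in> L3 \<or> (z, y) \<in> L3" for x y z
    using that magical_compose[OF m1, of x y z] magical_compose[OF m2, of x y z] E
      transD[OF orders(1), of x y z]
    by simp
  \<comment> \<open>The arc from \<open>x\<close> to \<open>v\<close> goes up in both orders, which
    suffices for \<open>compose\<close> whatever the next arc does.\<close>
  have extend: "(x, y) \<in> parcs G" if "(v, x) \<in> A" "(v, y) \<in> B \<union> C" for v x y
    using that symD[OF sym, of v x] compose[of x v y] by (auto simp: A_def B_def C_def)
  have AQ: "chain_height A v + chain_height Q v < k" if "v \<in> pverts G" "Q = B \<or> Q = C" for v Q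
    unfolding assms(3)[symmetric]
  proof (rule chain_heights_clique[OF finite_verts sym arcs that(1) orders(2,1)])
    show "A \<subseteq> parcs G \<inter> L1\<inverse>" "Q \<subseteq> parcs G \<inter> L1"
      using that(2) by (auto simp: A_def B_def C_def)
    show "(x, y) \<in> parcs G" if "(v, x) \<in> A" "(v, y) \<in> Q" for x y
      using extend[OF that(1)] that(2) \<open>Q = B \<or> Q = C\<close> by blast
  qed
  have D_le: "chain_height D v \<le> chain_height B v" "chain_height D v \<le> chain_height C v" for v
    by (intro chain_height_mono fin; simp add: D_def)+
  have "g v \<in> height_vectors k" if "v \<in> pverts G" for v
    using AQ[of v B] AQ[of v C] D_le[of v] that by (simp add: g_def height_vectors_def) linarith
  then have "g ` pverts G \<subseteq> height_vectors k"
    by blast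
  moreover have g_neq: "g u \<noteq> g v" if uv: "(u, v) \<in> parcs G" "(u, v) \<in> L1" for u v
  proof -
    have vu: "(v, u) \<in> parcs G"
      using symD[OF sym uv(1)] .
    have "u \<in> pverts G" "v \<in> pverts G" "u \<noteq> v"
      using uv(1) arcs loopless by auto
    then consider "(u, v) \<in> L2" "(u, v) \<in> L3" | "(u, v) \<in> L2" "(v, u) \<in> L3"
      | "(v, u) \<in> L2" "(u, v) \<in> L3" | "(v, u) \<in> L2" "(v, u) \<in> L3"
      using orders(6,9) unfolding total_on_def by blast
    then show ?thesis
    proof cases
      case 1
      \<comment> \<open>Here chains ending at \<open>u\<close> extend to \<open>v\<close>, so the
        height grows along the arc; in the other cases it falls.\<close>
      have "(v, x) \<in> A" if "(u, x) \<in> A" for x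
        using that 1 uv symD[OF sym, of u x] symD[OF sym, of x v] compose[of x u v]
          transD[OF orders(4), of x u v] transD[OF orders(7), of x u v]
        by (simp add: A_def)
      then have "A `` {u} \<subseteq> A `` {v}"
        by blast
      then show ?thesis
        using chain_height_less[OF fin(1) irr(1), of v u] 1 uv vu by (auto simp: A_def g_def)
    next
      case 2
      \<comment> \<open>The first arc goes up in \<open>L2\<close> and the second down in
        \<open>L3\<close>, so the direction of the second in \<open>L2\<close> is
        irrelevant.\<close>
      have "(u, x) \<in> B" if "(v, x) \<in> B" for x
        using that 2 uv compose[of u v x] transD[OF orders(7), of x v u]
        by (simp add: B_def)
      then have "B `` {v} \<subseteq> B `` {u}"
        by blast
      then show ?thesis
        using chain_height_less[OF fin(2) irr(2), of u v] 2 uv by (auto simp: B_def g_def)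
    next
      case 3
      have "(u, x) \<in> C" if "(v, x) \<in> C" for x
        using that 3 uv compose[of u v x] transD[OF orders(4), of x v u]
        by (simp add: C_def)
      then have "C `` {v} \<subseteq> C `` {u}"
        by blast
      then show ?thesis
        using chain_height_less[OF fin(3) irr(3), of u v] 3 uv by (auto simp: C_def g_def)
    next
      case 4
      \<comment> \<open>As the first arc goes down in both orders, \<open>compose\<close> needs the
        second to do so too; \<open>B\<close> or \<open>C\<close> alone would not ensure
        this.\<close>
      have "(u, x) \<in> D" if "(v, x) \<in> D" for x
        using that 4 uv compose[of u v x] transD[OF orders(4), of x v u]
          transD[OF orders(7), of x v u]
        by (simp add: B_def C_def D_def)
      then have "D `` {v} \<subseteq> D `` {u}"
        by blast
      then show ?thesis
        using chain_height_less[OF fin(4) irr(4), of u v] 4 uv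
        by (auto simp: B_def C_def D_def g_def)
    qed
  qed
  moreover have "g u \<noteq> g v" if "(u, v) \<in> parcs G" for u v
  proof -
    have "(u, v) \<in> L1 \<or> (v, u) \<in> L1"
      using that arcs loopless orders(3) unfolding total_on_def by blast
    then show ?thesis
      using that symD[OF sym that] g_neq[of u v] g_neq[of v u] by auto
  qed
  ultimately have "chromatic_number G \<le> card (height_vectors k)"
    using arcs by (intro chromatic_number_le_card) (auto simp: height_vectors_def)
  then show ?thesis
    using card_height_vectors[of k] by linarith
qed

end
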